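(* For every integer $n\geqslant 1$, $$t_n=\frac{1}{2\,(1+2v_3(n)-t_{n-1})}.$$
   Context: $v_3(n)$ denotes the $3$-adic valuation of the positive integer $n$. Define triples of integers $N_n=(a_n;b_n;c_n)$ for every integer $n\geqslant 1$ as the labels of the vertices of a ternary tree $\mathcal{A}_3$ read from the top and, at each level, from left to right. The top is $N_1=(1;2;0)$. For every $n\geqslant 1$, the left, middle and right children of $N_n=(a;b;c)$ are respectively $N_{3n-1}$, $N_{3n}$, $N_{3n+1}$, and they are given by: - if $b$ is odd: $N_{3n-1}=(4(c+1)a-b;\,2a;\,0)$, $N_{3n}=(a;\,2a+b;\,c+1)$, $N_{3n+1}=(2a+b;\,2a+2b;\,0)$; - if $b$ is even: $N_{3n-1}=(2(c+1)a-\frac{b}{2};\,a;\,0)$, $N_{3n}=(a;\,2a+b;\,c+1)$, $N_{3n+1}=(a+\frac{b}{2};\,a+b;\,0)$. The sequence $(t_n)_{n\geqslant 0}$ is defined by $t_0=0$ and $t_n=\frac{a_n}{b_n}$ for every $n\geqslant 1$. *)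

theory Defs
  imports Complex_Main "HOL-Computational_Algebra.Primes"
begin

type_synonym triple = "int \<times> int \<times> int"

fun left_child :: "triple \<Rightarrow> triple" where
  "left_child (a, b, c) =
     (if odd b then (4 * (c + 1) * a - b, 2 * a, 0)
      else (2 * (c + 1) * a - b div 2, a, 0))"

fun middle_child :: "triple \<Rightarrow> triple" where
  "middle_child (a, b, c) = (a, 2 * a + b, c + 1)"

fun right_child :: "triple \<Rightarrow> triple" where
  "right_child (a, b, c) =
     (if odd b then (2 * a + b, 2 * a + 2 * b, 0)
      else (a + b div 2, a + b, 0))"

text \<open>The children of vertex \<open>k \<ge> 1\<close> carry the indices \<open>3k - 1\<close>, \<open>3k\<close>, \<open>3k + 1\<close>, so the parent
  of vertex \<open>n \<ge> 2\<close> is \<open>(n + 1) div 3\<close>. Indices start at 1; the value at 0 is a dummy.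
  The defining recurrences are recovered in \<open>N_children\<close> below.\<close>

fun N :: "nat \<Rightarrow> triple" where
  "N n =
     (if n \<le> 1 then (1, 2, 0)
      else let p = N ((n + 1) div 3) in
        if n mod 3 = 2 then left_child p
        else if n mod 3 = 0 then middle_child p
        else right_child p)"

declare N.simps [simp del]

definition t :: "nat \<Rightarrow> rat" where
  "t n = (if n = 0 then 0 else (case N n of (a, b, c) \<Rightarrow> of_int a / of_int b))"

lemma N_1: "N 1 = (1, 2, 0)"
  by (simp add: N.simps)

lemma N_children:
  assumes "n \<ge> 1"
  shows "N (3 * n - 1) = left_child (N n)"
    and "N (3 * n) = middle_child (N n)"
    and "N (3 * n + 1) = right_child (N n)"
proof -
  obtain m where n: "n = Suc m"
    using assms by (cases n) auto
  have "(3 * m + 2) mod 3 = 2" "(3 * m + 2 + 1) div 3 = Suc m" "\<not> 3 * m + 2 \<le> 1"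
    by (presburger, simp_all)
  then have "N (3 * m + 2) = left_child (N (Suc m))"
    by (subst N.simps) (simp only: if_False if_True Let_def refl)
  moreover have "3 * n - 1 = 3 * m + 2"
    using n by simp
  ultimately show "N (3 * n - 1) = left_child (N n)"
    using n by (simp only:)
  have *: "(3 * n) mod 3 = 0" "(3 * n + 1) div 3 = n" "\<not> 3 * n \<le> 1"
    using assms by simp_all
  show "N (3 * n) = middle_child (N n)"
    by (subst N.simps) (simp only: * if_False if_True Let_def, simp)
  have **: "(3 * n + 1) mod 3 = 1" "(3 * n + 1 + 1) div 3 = n" "\<not> 3 * n + 1 \<le> 1"
    using assms by simp_all
  show "N (3 * n + 1) = right_child (N n)"
    by (subst N.simps) (simp only: ** if_False if_True Let_def, simp)
qed

text \<open>Here \<open>b > 0\<close> ensures that the quotient in \<open>t\<close> never divides by zero.\<close>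

lemma N_pos:
  "case N n of (a, b, c) \<Rightarrow> a > 0 \<and> b > 0 \<and> c \<ge> 0 \<and> b \<le> 2 * (c + 1) * a"
proof (induction n rule: N.induct)
  case (1 n)
  show ?case
  proof (cases "n \<le> 1")
    case True
    then show ?thesis by (simp add: N.simps)
  next
    case False
    obtain a b c where p: "N ((n + 1) div 3) = (a, b, c)"
      by (metis prod_cases3)
    have ih: "a > 0" "b > 0" "c \<ge> 0" "b \<le> 2 * (c + 1) * a"
      using 1[OF False] p by simp_all
    have ca: "c * a \<ge> 0" using ih by simp
    have ba: "b \<le> 2 * (c * a) + 2 * a" using ih by (simp add: algebra_simps)
    have "N n \<in> {left_child (a, b, c), middle_child (a, b, c), right_child (a, b, c)}"
      using False p by (subst N.simps) (simp add: Let_def)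
    moreover have "a \<le> 2 * (2 * (c + 1) * a - b div 2)" "2 * (c + 1) * a - b div 2 > 0"
      "a + b div 2 > 0" "a + b \<le> 2 * (a + b div 2)" if ev: "even b"
    proof -
      obtain d where "b = 2 * d" using ev by blast
      then show "a \<le> 2 * (2 * (c + 1) * a - b div 2)" "2 * (c + 1) * a - b div 2 > 0"
        "a + b div 2 > 0" "a + b \<le> 2 * (a + b div 2)"
        using ih(1,2) ca ba unfolding distrib_left distrib_right mult.assoc by simp_all
    qed
    moreover have "2 * a \<le> 2 * (4 * (c + 1) * a - b)" "4 * (c + 1) * a - b > 0"
      "2 * a + b \<le> (4 + 2 * c) * a"
      using ih(1,2) ca ba unfolding distrib_left distrib_right mult.assoc by simp_all
    ultimately show ?thesis
      using ih(1-3) by (cases "even b") auto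
  qed
qed

end

theory Submission
  imports Defs
begin

text \<open>
  The parity distinction in the tree only fixes how the quotient \<open>a / b\<close> is represented as a
  pair: on the level of quotients the two cases agree, and the three children of a vertex with
  quotient \<open>x\<close> have the quotients \<open>2 (c + 1) - 1 / (2 x)\<close>, \<open>x / (1 + 2 x)\<close> and
  \<open>(1 + 2 x) / (2 (1 + x))\<close>. Moreover \<open>c\<close> counts the middle steps that lead down to the vertex
  since the last other step. As a middle step multiplies the index by \<open>3\<close> and the other
  children have indices prime to \<open>3\<close>, the third entry of \<open>N n\<close> is the \<open>3\<close>-adic valuation
  of \<open>n\<close>.

  With these formulas, the recurrence between \<open>t (3 k - 1)\<close> and \<open>t (3 k)\<close>, and between
  \<open>t (3 k)\<close> and \<open>t (3 k + 1)\<close>, relates siblings and is an identity in \<open>t k\<close>. The step from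
  \<open>t (3 k + 1)\<close> to \<open>t (3 k + 2)\<close> passes from the last child of \<open>k\<close> to the first child of
  \<open>k + 1\<close>. There the recurrence amounts to \<open>t (3 k + 2) = 1 + t k\<close>, which is the recurrence
  between the parents, so the proof is an induction on \<open>n\<close>.
\<close>

lemma t_eq_quotient: "n \<ge> 1 \<Longrightarrow> N n = (a, b, c) \<Longrightarrow> t n = of_int a / of_int b"
  by (simp add: t_def)

lemma t_pos:
  assumes "n \<ge> 1"
  shows "t n > 0"
proof -
  obtain a b c where "N n = (a, b, c)"
    by (metis prod_cases3)
  then show ?thesis
    using N_pos[of n] assms by (simp add: t_eq_quotient)
qed

lemma t_nonneg: "t n \<ge> 0"
  using t_pos[of n] by (cases "n \<ge> 1") (simp_all add: t_def)

text \<open>Induction along the branch from the root: the left and right children reset the third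
  entry and have indices not divisible by \<open>3\<close>; the middle child increases both the entry and
  the valuation by one.\<close>

lemma N_third_eq_multiplicity:
  assumes "n \<ge> 1"
  shows "snd (snd (N n)) = int (multiplicity 3 n)"
  using assms
proof (induction n rule: less_induct)
  case (less n)
  show ?case
  proof (cases "n = 1")
    case True
    then show ?thesis by (simp add: N.simps)
  next
    case False
    define k where "k = (n + 1) div 3"
    have k: "k \<ge> 1" "k < n"
      using less.prems False by (auto simp: k_def)
    obtain a b c where Nk: "N k = (a, b, c)"
      by (metis prod_cases3)
    have "n = 3 * k - 1 \<or> n = 3 * k \<or> n = 3 * k + 1"
      unfolding k_def by presburger
    then consider "n = 3 * k - 1" | "n = 3 * k" | "n = 3 * k + 1"
      by blast
    then show ?thesis
    proof cases
      case 1
      then have "\<not> 3 dvd n"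
        using k by presburger
      then show ?thesis
        using N_children(1)[OF k(1)] 1 Nk by (simp add: not_dvd_imp_multiplicity_0)
    next
      case 2
      then have "multiplicity 3 n = Suc (multiplicity 3 k)"
        using k by (simp add: multiplicity_times_same)
      then show ?thesis
        using N_children(2)[OF k(1)] less.IH[OF k(2,1)] 2 Nk by simp
    next
      case 3
      then have "\<not> 3 dvd n"
        by presburger
      then show ?thesis
        using N_children(3)[OF k(1)] 3 Nk by (simp add: not_dvd_imp_multiplicity_0)
    qed
  qed
qed

lemma t_left_child:
  assumes "k \<ge> 1"
  shows "t (3 * k - 1) = 2 * (of_nat (multiplicity 3 k) + 1) - 1 / (2 * t k)"
proof -
  obtain a b c where Nk: "N k = (a, b, c)"
    by (metis prod_cases3)
  have pos: "a > 0" "b > 0"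
    using N_pos[of k] Nk by simp_all
  have c: "(of_nat (multiplicity 3 k) :: rat) = of_int c"
    using N_third_eq_multiplicity[OF assms] Nk by simp
  have child: "t (3 * k - 1) = (case left_child (a, b, c) of (a, b, c) \<Rightarrow> of_int a / of_int b)"
    using N_children(1)[OF assms] Nk assms by (simp add: t_def)
  show ?thesis
  proof (cases "even b")
    case True
    then obtain d where "b = 2 * d" by blast
    then show ?thesis
      using child pos assms by (simp add: c t_eq_quotient[OF _ Nk] field_simps)
  next
    case False
    then show ?thesis
      using child pos assms by (simp add: c t_eq_quotient[OF _ Nk] field_simps)
  qed
qed

text \<open>For the two remaining children the formulas also hold at \<open>k = 0\<close>, as \<open>t 0 = 0\<close> and
  \<open>t 1 = 1 / 2\<close>. The root thus behaves like a right child of a vertex with quotient \<open>0\<close>, and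
  the recurrence needs no separate treatment of small \<open>n\<close>.\<close>

lemma t_middle_child: "t (3 * k) = t k / (1 + 2 * t k)"
proof (cases "k = 0")
  case True
  then show ?thesis by (simp add: t_def)
next
  case False
  then have k: "k \<ge> 1" by simp
  obtain a b c where Nk: "N k = (a, b, c)"
    by (metis prod_cases3)
  have pos: "a > 0" "b > 0"
    using N_pos[of k] Nk by simp_all
  have "of_int (2 * a + b) > (0 :: rat)"
    using pos by (simp only: of_int_0_less_iff)
  moreover have "t (3 * k) = of_int a / of_int (2 * a + b)"
    using N_children(2)[OF k] Nk k by (simp add: t_def)
  ultimately show ?thesis
    using pos by (simp add: t_eq_quotient[OF k Nk] field_simps)
qed

lemma t_right_child: "t (3 * k + 1) = (1 + 2 * t k) / (2 * (1 + t k))"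
proof (cases "k = 0")
  case True
  then show ?thesis by (simp add: t_def N.simps)
next
  case False
  then have k: "k \<ge> 1" by simp
  obtain a b c where Nk: "N k = (a, b, c)"
    by (metis prod_cases3)
  have pos: "a > 0" "b > 0"
    using N_pos[of k] Nk by simp_all
  have "of_int (a + b) > (0 :: rat)"
    using pos by (simp only: of_int_0_less_iff)
  then have sum: "of_int a + of_int b > (0 :: rat)"
    by simp
  have child: "t (3 * k + 1) = (case right_child (a, b, c) of (a, b, c) \<Rightarrow> of_int a / of_int b)"
    using N_children(3)[OF k] Nk by (simp add: t_def)
  have "t (3 * k + 1) = (2 * of_int a + of_int b) / (2 * (of_int a + of_int b))"
  proof (cases "even b")
    case True
    then obtain d where "b = 2 * d" by blast
    then show ?thesis
      using child sum by (simp add: field_simps)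
  next
    case False
    then show ?thesis
      using child by simp
  qed
  also have "\<dots> = (1 + 2 * t k) / (2 * (1 + t k))"
  proof -
    have "1 + 2 * t k = (2 * of_int a + of_int b) / of_int b"
      "1 + t k = (of_int a + of_int b) / of_int b"
      using pos by (simp_all add: t_eq_quotient[OF k Nk] field_simps)
    then show ?thesis
      using pos by simp
  qed
  finally show ?thesis .
qed

theorem proposition1:
  fixes n :: nat
  assumes "n \<ge> 1"
  shows "t n = 1 / (2 * (1 + 2 * of_nat (multiplicity 3 n) - t (n - 1)))"
  using assms
proof (induction n rule: less_induct)
  case (less n)
  define k where "k = n div 3"
  have "n = 3 * k \<or> n = 3 * k + 1 \<or> n = 3 * k + 2"
    unfolding k_def by presburger
  then consider "n = 3 * k" | "n = 3 * k + 1" | "n = 3 * k + 2"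
    by blast
  then show ?case
  proof cases
    case 1
    then have k: "k \<ge> 1"
      using less.prems by simp
    have "multiplicity 3 n = Suc (multiplicity 3 k)"
      using 1 k by (simp add: multiplicity_times_same)
    then have "2 * (1 + 2 * of_nat (multiplicity 3 n) - t (n - 1)) = 2 + 1 / t k"
      using 1 t_left_child[OF k] by (simp add: algebra_simps)
    moreover have "t n = 1 / (2 + 1 / t k)"
      using 1 t_middle_child[of k] t_pos[OF k] by (simp add: field_simps)
    ultimately show ?thesis by simp
  next
    case 2
    then have "\<not> 3 dvd n"
      by presburger
    then have "2 * (1 + 2 * of_nat (multiplicity 3 n) - t (n - 1))
        = 2 * (1 - t k / (1 + 2 * t k))"
      using 2 t_middle_child[of k] by (simp add: not_dvd_imp_multiplicity_0)
    also have "\<dots> = 2 * (1 + t k) / (1 + 2 * t k)"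
      using t_nonneg[of k] by (simp add: field_simps)
    finally show ?thesis
      using 2 t_right_child[of k] by simp
  next
    case 3
    then have "\<not> 3 dvd n"
      by presburger
    then have "2 * (1 + 2 * of_nat (multiplicity 3 n) - t (n - 1))
        = 2 * (1 - (1 + 2 * t k) / (2 * (1 + t k)))"
      using 3 t_right_child[of k] by (simp add: not_dvd_imp_multiplicity_0)
    also have "\<dots> = 1 / (1 + t k)"
      using t_nonneg[of k] by (simp add: field_simps)
    finally have rhs: "1 / (2 * (1 + 2 * of_nat (multiplicity 3 n) - t (n - 1))) = 1 + t k"
      by simp
    have "t (k + 1) = 1 / (2 * (1 + 2 * of_nat (multiplicity 3 (k + 1)) - t k))"
      using less.IH[of "k + 1"] 3 by simp
    then have "1 / (2 * t (k + 1)) = 1 + 2 * of_nat (multiplicity 3 (k + 1)) - t k"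
      by simp
    then have "t n = 1 + t k"
      using 3 t_left_child[of "k + 1"] by simp
    then show ?thesis
      using rhs by simp
  qed
qed

end
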